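(* Let $\mathcal{A}$ be a set of actions and $\ell:\mathcal{A}\times\{0,1\}\to\mathbb{R}$ a bounded loss. For $p\in[0,1]$ let $\pi(p)\in\arg\min_{a\in\mathcal{A}}\mathbb{E}_{y\sim\mathrm{Ber}(p)}[\ell(a,y)]$ (the minimum is assumed attained and one minimizer is fixed for each $p$), and suppose that $p\mapsto \ell(\pi(p),1)-\ell(\pi(p),0)$ is continuous on $[0,1]$. Let $B=\sup_{a\in\mathcal{A}}|\ell(a,1)-\ell(a,0)|$ and $$\Phi(p)=\begin{bmatrix}\ell(\pi(p),1)-\ell(\pi(p),0)\\ B\end{bmatrix}\in\mathbb{R}^2 .$$ For any $T\ge 1$ and any sequence of outcomes $y_1,\dots,y_T\in\{0,1\}$ (each $y_t$ revealed after $p_t$ is chosen, and possibly chosen with knowledge of $p_t$), let $p_1,\dots,p_T\in[0,1]$ be the predictions produced by Defensive Forecasting for matching empirical moments with feature map $\Phi$, and let $a_t=\pi(p_t)$. Then $$\sum_{t=1}^T\ell(a_t,y_t)-\min_{a_\star\in\mathcal{A}}\sum_{t=1}^T\ell(a_\star,y_t)\le 2B\sqrt{2T}.$$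
   Context: $\mathrm{Ber}(p)$ is the Bernoulli distribution on $\{0,1\}$ with mean $p$. The minimum over $a_\star$ is assumed to be attained, as the notation indicates. Anticorrelation search: given a function $S:[0,1]\to\mathbb{R}$, return $p=1$ if $S(1)\ge 0$; otherwise return $p=0$ if $S(0)\le 0$; otherwise return some $p\in[0,1]$ with $S(p)=0$ (exact root finding). Defensive Forecasting for matching empirical moments with feature map $\Phi$ (here with no contexts): at each round $t$, define $S_t(p)=\sum_{s=1}^{t-1}\langle\Phi(p),\Phi(p_s)\rangle(y_s-p_s)$ (so $S_1\equiv 0$), let $p_t$ be the output of anticorrelation search on $S_t$, then observe $y_t$. *)

theory Defs
  imports "HOL-Probability.Probability"
begin

text \<open>
  Outcomes in \<open>{0, 1}\<close> are booleans, \<open>True\<close> being \<open>1\<close> and \<open>False\<close> being \<open>0\<close>; the numerical value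
  of an outcome is given by \<open>of_bool\<close>, and \<open>Ber(p)\<close> is \<open>bernoulli_pmf p\<close>.
\<close>

definition loss_gap :: "('a \<Rightarrow> bool \<Rightarrow> real) \<Rightarrow> 'a \<Rightarrow> real" where
  "loss_gap loss a = loss a True - loss a False"

definition gap_bound :: "'a set \<Rightarrow> ('a \<Rightarrow> bool \<Rightarrow> real) \<Rightarrow> real" where
  "gap_bound A loss = (SUP a\<in>A. \<bar>loss_gap loss a\<bar>)"

definition action_features ::
  "'a set \<Rightarrow> ('a \<Rightarrow> bool \<Rightarrow> real) \<Rightarrow> (real \<Rightarrow> 'a) \<Rightarrow> real \<Rightarrow> real ^ 2" where
  "action_features A loss \<pi> p = vector [loss_gap loss (\<pi> p), gap_bound A loss]"

text \<open>
  Exact root finding may return any root, so anticorrelation search is a relation between the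
  function \<open>S\<close> and its possible outputs. Only the values of \<open>S\<close> on \<open>[0, 1]\<close> are used.
\<close>

definition anticorrelation_search :: "(real \<Rightarrow> real) \<Rightarrow> real \<Rightarrow> bool" where
  "anticorrelation_search S p \<longleftrightarrow>
     (if S 1 \<ge> 0 then p = 1
      else if S 0 \<le> 0 then p = 0
      else p \<in> {0..1} \<and> S p = 0)"

definition moment_correlation ::
  "(real \<Rightarrow> 'v::real_inner) \<Rightarrow> (nat \<Rightarrow> real) \<Rightarrow> (nat \<Rightarrow> bool) \<Rightarrow> nat \<Rightarrow> real \<Rightarrow> real" where
  "moment_correlation \<Phi> p y t q =
     (\<Sum>s = 1..<t. (\<Phi> q \<bullet> \<Phi> (p s)) * (of_bool (y s) - p s))"

text \<open>
  \<open>p\<close> and \<open>y\<close> form a possible transcript of \<open>T\<close> rounds. The prediction of round \<open>t\<close> depends only on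
  earlier rounds, while \<open>y t\<close> is unconstrained, so outcomes chosen in response to the current and
  the past predictions are included.
\<close>

definition defensive_forecasting ::
  "(real \<Rightarrow> 'v::real_inner) \<Rightarrow> nat \<Rightarrow> (nat \<Rightarrow> real) \<Rightarrow> (nat \<Rightarrow> bool) \<Rightarrow> bool" where
  "defensive_forecasting \<Phi> T p y \<longleftrightarrow>
     (\<forall>t\<in>{1..T}. anticorrelation_search (moment_correlation \<Phi> p y t) (p t))"

end

theory Submission imports Defs begin

text \<open>
  Anticorrelation search makes the cross terms in the expansion of
  \<open>\<parallel>\<Sum>\<^sub>t (y\<^sub>t - p\<^sub>t) \<Phi>(p\<^sub>t)\<parallel>\<^sup>2\<close> nonpositive, so this norm is at most \<open>B \<surd>(2T)\<close>.
  Since \<open>loss a y = E\<^bsub>Ber(p)\<^esub> (loss a) + (y - p) loss_gap loss a\<close> and \<open>\<pi> (p\<^sub>t)\<close> is a best response to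
  \<open>p\<^sub>t\<close>, the regret is at most
  \<open>\<Sum>\<^sub>t (y\<^sub>t - p\<^sub>t) loss_gap loss (\<pi> (p\<^sub>t)) - loss_gap loss a\<^sub>\<star> \<Sum>\<^sub>t (y\<^sub>t - p\<^sub>t)\<close>,
  and each of the two terms is bounded by the absolute value of one coordinate of
  \<open>\<Sum>\<^sub>t (y\<^sub>t - p\<^sub>t) \<Phi>(p\<^sub>t)\<close>.
\<close>

lemma anticorrelation_search_in_unit_interval:
  "anticorrelation_search S p \<Longrightarrow> p \<in> {0..1}"
  by (auto simp: anticorrelation_search_def split: if_splits)

text \<open>At \<open>p = 1\<close> the value \<open>S 1\<close> is nonnegative and
  \<open>of_bool b - p\<close> nonpositive; at \<open>p = 0\<close> both signs flip; any other
  output is a root of \<open>S\<close>.\<close>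

lemma anticorrelation_search_nonpos:
  "anticorrelation_search S p \<Longrightarrow> S p * (of_bool b - p) \<le> 0"
  by (cases b) (auto simp: anticorrelation_search_def split: if_splits)

lemma defensive_forecasting_moment_bound:
  fixes \<Phi> :: "real \<Rightarrow> 'v::real_inner"
  assumes "defensive_forecasting \<Phi> T p y"
    and bound: "\<And>q. q \<in> {0..1} \<Longrightarrow> (norm (\<Phi> q))\<^sup>2 \<le> C"
  shows "(norm (\<Sum>t = 1..T. (of_bool (y t) - p t) *\<^sub>R \<Phi> (p t)))\<^sup>2 \<le> C * T"
  using assms(1)
proof (induction T)
  case 0
  then show ?case by simp
next
  case (Suc T)
  define M where "M = (\<Sum>t = 1..T. (of_bool (y t) - p t) *\<^sub>R \<Phi> (p t))"
  define d where "d = of_bool (y (Suc T)) - p (Suc T)"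
  define v where "v = \<Phi> (p (Suc T))"
  have IH: "(norm M)\<^sup>2 \<le> C * T"
    using Suc unfolding M_def by (simp add: defensive_forecasting_def)
  have search: "anticorrelation_search (moment_correlation \<Phi> p y (Suc T)) (p (Suc T))"
    using Suc.prems by (simp add: defensive_forecasting_def)
  have unit: "p (Suc T) \<in> {0..1}"
    by (rule anticorrelation_search_in_unit_interval [OF search])
  \<comment> \<open>The sum in round \<open>Suc T\<close> runs over exactly the rounds accumulated
    in \<open>M\<close>, so the searched function, evaluated at its own output, is the cross term of
    the squared norm.\<close>
  have "moment_correlation \<Phi> p y (Suc T) (p (Suc T)) = v \<bullet> M"
    by (simp add: moment_correlation_def M_def v_def inner_sum_right atLeastLessThanSuc_atLeastAtMost mult.commute)
  then have cross: "(v \<bullet> M) * d \<le> 0"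
    using anticorrelation_search_nonpos [OF search] by (simp add: d_def)
  have "d\<^sup>2 \<le> 1"
    using unit by (cases "y (Suc T)") (auto simp: d_def abs_square_le_1)
  then have "d\<^sup>2 * (norm v)\<^sup>2 \<le> 1 * C"
    using bound [OF unit] by (intro mult_mono) (auto simp: v_def)
  moreover have "(norm (M + d *\<^sub>R v))\<^sup>2 = (norm M)\<^sup>2 + 2 * ((v \<bullet> M) * d) + d\<^sup>2 * (norm v)\<^sup>2"
    unfolding power2_norm_eq_inner
    by (simp add: inner_left_distrib inner_right_distrib inner_commute power2_eq_square algebra_simps)
  ultimately have "(norm (M + d *\<^sub>R v))\<^sup>2 \<le> C * Suc T"
    using IH cross by (simp add: algebra_simps)
  then show ?case
    by (simp add: M_def d_def v_def)
qed

text \<open>A function on two points is affine in \<open>of_bool b\<close>, here with slope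
  \<open>loss_gap loss a\<close>, and \<open>q\<close> is the mean outcome.\<close>

lemma expectation_bernoulli_loss:
  assumes "q \<in> {0..1}"
  shows "measure_pmf.expectation (bernoulli_pmf q) (loss a) = loss a b - (of_bool b - q) * loss_gap loss a"
  using assms by (cases b) (auto simp: loss_gap_def algebra_simps)

text \<open>Bounded losses make the set of gaps bounded above, so the real-valued \<open>SUP\<close>
  is a genuine upper bound.\<close>

lemma abs_loss_gap_le_gap_bound:
  assumes "bounded ((\<lambda>(a, b). loss a b) ` (A \<times> UNIV))" and "a \<in> A"
  shows "\<bar>loss_gap loss a\<bar> \<le> gap_bound A loss"
  unfolding gap_bound_def
proof (rule cSUP_upper [OF \<open>a \<in> A\<close>])
  obtain K where K: "\<And>a b. a \<in> A \<Longrightarrow> \<bar>loss a b\<bar> \<le> K"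
    using assms(1) by (fastforce simp: bounded_iff)
  have "\<bar>loss_gap loss a\<bar> \<le> 2 * K" if "a \<in> A" for a
    using K [OF that, of True] K [OF that, of False] unfolding loss_gap_def by linarith
  then show "bdd_above ((\<lambda>a. \<bar>loss_gap loss a\<bar>) ` A)"
    by (auto intro!: bdd_aboveI2)
qed

lemma norm_action_features_sq:
  "(norm (action_features A loss \<pi> q))\<^sup>2 = (loss_gap loss (\<pi> q))\<^sup>2 + (gap_bound A loss)\<^sup>2"
  unfolding power2_norm_eq_inner
  by (simp add: action_features_def inner_vec_def sum_2 vector_2 power2_eq_square)

theorem mainTheorem1:
  fixes A :: "'a set"
    and loss :: "'a \<Rightarrow> bool \<Rightarrow> real"
    and \<pi> :: "real \<Rightarrow> 'a"
    and T :: nat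
    and p :: "nat \<Rightarrow> real"
    and y :: "nat \<Rightarrow> bool"
    and a_star :: 'a
  assumes bounded_loss: "bounded ((\<lambda>(a, b). loss a b) ` (A \<times> UNIV))"
    and best_response: "\<And>q. q \<in> {0..1} \<Longrightarrow>
          is_arg_min (\<lambda>a. measure_pmf.expectation (bernoulli_pmf q) (loss a)) (\<lambda>a. a \<in> A) (\<pi> q)"
    and continuous_gap: "continuous_on {0..1} (\<lambda>q. loss (\<pi> q) True - loss (\<pi> q) False)"
    and T_pos: "T \<ge> 1"
    and forecasts: "defensive_forecasting (action_features A loss \<pi>) T p y"
    and minimizer: "is_arg_min (\<lambda>a. \<Sum>t = 1..T. loss a (y t)) (\<lambda>a. a \<in> A) a_star"
  shows "(\<Sum>t = 1..T. loss (\<pi> (p t)) (y t)) - (\<Sum>t = 1..T. loss a_star (y t))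
           \<le> 2 * gap_bound A loss * sqrt (2 * real T)"
proof -
  define B where "B = gap_bound A loss"
  define d where "d t = of_bool (y t) - p t" for t
  define M where "M = (\<Sum>t = 1..T. d t *\<^sub>R action_features A loss \<pi> (p t))"
  have unit: "p t \<in> {0..1}" if "t \<in> {1..T}" for t
    using forecasts that anticorrelation_search_in_unit_interval
    unfolding defensive_forecasting_def by blast
  have response: "\<pi> q \<in> A" if "q \<in> {0..1}" for q
    using best_response [OF that] by (simp add: is_arg_min_def)
  have star: "a_star \<in> A"
    using minimizer by (simp add: is_arg_min_def)
  have gap: "\<bar>loss_gap loss a\<bar> \<le> B" if "a \<in> A" for a
    using abs_loss_gap_le_gap_bound [OF bounded_loss that] by (simp add: B_def)
  have B_nonneg: "B \<ge> 0"
    using gap [OF star] by linarith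
  \<comment> \<open>Both features are at most \<open>B\<close> in absolute value; this is the source
    of the factor 2 under the root.\<close>
  have "(norm (action_features A loss \<pi> q))\<^sup>2 \<le> 2 * B\<^sup>2" if "q \<in> {0..1}" for q
    using power_mono [OF gap [OF response [OF that]] abs_ge_zero, of 2]
    by (simp add: norm_action_features_sq B_def)
  then have "(norm M)\<^sup>2 \<le> 2 * B\<^sup>2 * T"
    unfolding M_def d_def by (rule defensive_forecasting_moment_bound [OF forecasts])
  then have "norm M \<le> sqrt (B\<^sup>2 * (2 * T))"
    by (intro real_le_rsqrt) (simp add: ac_simps)
  then have norm_M: "norm M \<le> B * sqrt (2 * T)"
    using B_nonneg by (simp add: real_sqrt_mult)
  have M1: "M $ 1 = (\<Sum>t = 1..T. d t * loss_gap loss (\<pi> (p t)))"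
    and M2: "M $ 2 = B * (\<Sum>t = 1..T. d t)"
    by (simp_all add: M_def action_features_def vector_2 B_def sum_distrib_left mult.commute)
  have "loss (\<pi> (p t)) (y t) - loss a_star (y t)
      \<le> d t * loss_gap loss (\<pi> (p t)) - loss_gap loss a_star * d t" if "t \<in> {1..T}" for t
  proof -
    have "measure_pmf.expectation (bernoulli_pmf (p t)) (loss (\<pi> (p t)))
        \<le> measure_pmf.expectation (bernoulli_pmf (p t)) (loss a_star)"
      using best_response [OF unit [OF that]] star by (simp add: is_arg_min_linorder)
    then show ?thesis
      unfolding expectation_bernoulli_loss [OF unit [OF that], of _ _ "y t"] d_def
      by (simp add: algebra_simps)
  qed
  then have "(\<Sum>t = 1..T. loss (\<pi> (p t)) (y t) - loss a_star (y t))
      \<le> (\<Sum>t = 1..T. d t * loss_gap loss (\<pi> (p t)) - loss_gap loss a_star * d t)"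
    by (rule sum_mono)
  then have "(\<Sum>t = 1..T. loss (\<pi> (p t)) (y t)) - (\<Sum>t = 1..T. loss a_star (y t))
      \<le> M $ 1 - loss_gap loss a_star * (\<Sum>t = 1..T. d t)"
    by (simp add: M1 sum_subtractf sum_distrib_left)
  also have "\<dots> \<le> \<bar>M $ 1\<bar> + \<bar>loss_gap loss a_star * (\<Sum>t = 1..T. d t)\<bar>"
    by linarith
  \<comment> \<open>The constant feature \<open>B\<close> dominates the gap of every competitor,
    whichever \<open>a_star\<close> is optimal in hindsight.\<close>
  also have "\<dots> \<le> \<bar>M $ 1\<bar> + \<bar>M $ 2\<bar>"
    using mult_right_mono [OF gap [OF star] abs_ge_zero, of "\<Sum>t = 1..T. d t"] B_nonneg
    by (simp add: M2 abs_mult)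
  also have "\<dots> \<le> 2 * norm M"
    using component_le_norm_cart [of M 1] component_le_norm_cart [of M 2] by linarith
  finally show ?thesis
    using norm_M by (simp add: B_def)
qed

end
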